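(* Let $n\ge 3$, $1\le k<n$, and let $F$ be a real 2-uniform $(n,k)$-frame. Then for $2\le p<\infty$, $$e_3^p(F)=\left(\binom{n}{3}^{-1}\left[\left(\frac{k}{n}+2c_{n,k}\right)^pE_3+\left(\frac{k}{n}+c_{n,k}\right)^pO_3\right]\right)^{1/p},\qquad c_{n,k}=\sqrt{\frac{k(n-k)}{n^2(n-1)}},$$ where $$O_3=\frac{v(n-1)c}{6}+(n-2v+c)\frac{(n-1)v}{2},\qquad E_3=\binom{n}{3}-O_3,$$ $$v=\frac12\left(n-2-\sqrt{\frac{(n-k)(n-1)}{k}}+\sqrt{\frac{k(n-1)}{n-k}}\right),$$ $$c=v-1-\frac14\left(\sqrt{\frac{(n-k)(n-1)}{k}}-1\right)\left(\sqrt{\frac{k(n-1)}{n-k}}+1\right).$$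
   Context: A real $(n,k)$-frame is a family $F=\{f_1,\dots,f_n\}$ of $n$ vectors in $\mathbb{R}^k$ that is Parseval: $\|x\|^2=\sum_j|\langle x,f_j\rangle|^2$ for all $x\in\mathbb{R}^k$. Its analysis operator is $V:\mathbb{R}^k\to\mathbb{R}^n$, $(Vx)_i=\langle x,f_i\rangle$. It is uniform if all $\|f_j\|$ are equal. Let $\mathcal{D}_m$ be the set of $n\times n$ diagonal matrices with exactly $m$ diagonal entries equal to $1$ and $n-m$ equal to $0$. $F$ is 2-uniform if it is uniform and $\|V^*DV\|$ is the same for all $D\in\mathcal{D}_2$. Norms of matrices are operator norms. For $1\le p<\infty$ define $$e_m^p(F)=\left(\binom{n}{m}^{-1}\sum_{D\in\mathcal{D}_m}\|V^*DV\|^p\right)^{1/p}.$$ (In the paper, $E_3$ and $O_3$ are the numbers of 3-element vertex subsets whose induced subgraph has an even, respectively odd, number of edges, in the graph $G_F$ on $\{1,\dots,n\}$ in which distinct $i,j$ are adjacent iff $\langle f_j,f_i\rangle<0$; an even-edged graph on 3 vertices is the same as a complete bipartite one, where the edgeless graph counts as complete bipartite.) *)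

theory Defs
  imports "HOL-Analysis.Analysis"
begin

text \<open>A frame is a family, not a set: vectors may be repeated (already for k = 1). An
  (n,k)-frame is a map \<open>F :: 'n \<Rightarrow> real ^ 'k\<close> with n = \<open>CARD('n)\<close> and k = \<open>CARD('k)\<close>; the index
  type \<open>'n\<close> plays the role of {1, ..., n}.\<close>

definition parseval_frame :: "('n::finite \<Rightarrow> real ^ 'k) \<Rightarrow> bool" where
  "parseval_frame F \<longleftrightarrow> (\<forall>x. (norm x)\<^sup>2 = (\<Sum>j\<in>UNIV. \<bar>x \<bullet> F j\<bar>\<^sup>2))"

definition analysis_op :: "('n::finite \<Rightarrow> real ^ 'k) \<Rightarrow> real ^ 'k \<Rightarrow> real ^ 'n" where
  "analysis_op F x = (\<chi> i. x \<bullet> F i)"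

definition diag_projections :: "nat \<Rightarrow> (real ^ 'n ^ 'n) set" where
  "diag_projections m = {D. (\<forall>i j. i \<noteq> j \<longrightarrow> D $ i $ j = 0) \<and> (\<forall>i. D $ i $ i \<in> {0, 1}) \<and>
      card {i. D $ i $ i = 1} = m}"

text \<open>The operator norm of \<open>V\<^sup>* D V\<close>, where \<open>V\<close> is the analysis operator of \<open>F\<close>.\<close>

definition erasure_norm :: "('n::finite \<Rightarrow> real ^ 'k) \<Rightarrow> real ^ 'n ^ 'n \<Rightarrow> real" where
  "erasure_norm F D = onorm (adjoint (analysis_op F) \<circ> (*v) D \<circ> analysis_op F)"

definition uniform_frame :: "('n::finite \<Rightarrow> real ^ 'k) \<Rightarrow> bool" where
  "uniform_frame F \<longleftrightarrow> (\<forall>i j. norm (F i) = norm (F j))"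

definition two_uniform_frame :: "('n::finite \<Rightarrow> real ^ 'k) \<Rightarrow> bool" where
  "two_uniform_frame F \<longleftrightarrow> uniform_frame F \<and>
     (\<forall>D\<in>diag_projections 2. \<forall>D'\<in>diag_projections 2. erasure_norm F D = erasure_norm F D')"

definition erasure_error :: "nat \<Rightarrow> real \<Rightarrow> ('n::finite \<Rightarrow> real ^ 'k) \<Rightarrow> real" where
  "erasure_error m p F =
     (inverse (real (CARD('n) choose m)) *
       (\<Sum>D\<in>diag_projections m. erasure_norm F D powr p)) powr (1 / p)"

definition frame_adj :: "('n \<Rightarrow> real ^ 'k) \<Rightarrow> 'n \<Rightarrow> 'n \<Rightarrow> bool" where
  "frame_adj F i j \<longleftrightarrow> i \<noteq> j \<and> F j \<bullet> F i < 0"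

definition induced_edges :: "('n \<Rightarrow> real ^ 'k) \<Rightarrow> 'n set \<Rightarrow> 'n set set" where
  "induced_edges F S = {{i, j} |i j. i \<in> S \<and> j \<in> S \<and> frame_adj F i j}"

definition even_triples :: "('n::finite \<Rightarrow> real ^ 'k) \<Rightarrow> nat" where
  "even_triples F = card {S. card S = 3 \<and> even (card (induced_edges F S))}"

definition odd_triples :: "('n::finite \<Rightarrow> real ^ 'k) \<Rightarrow> nat" where
  "odd_triples F = card {S. card S = 3 \<and> odd (card (induced_edges F S))}"

definition equiangular_const :: "nat \<Rightarrow> nat \<Rightarrow> real" where
  "equiangular_const n k = sqrt (real k * (real n - real k) / ((real n)\<^sup>2 * (real n - 1)))"

end

theory Submission
  imports Defs
begin

text \<open>
  The norm of \<open>V\<^sup>* D V\<close> is the largest eigenvalue of the principal submatrix of the Gram matrix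
  \<open>G = V V\<^sup>*\<close> selected by \<open>D\<close>. On pairs it equals \<open>k/n + \<bar>G\<^sub>i\<^sub>j\<bar>\<close>, so 2-uniformity makes the frame
  equiangular: \<open>G = (k/n) I + b Q\<close> with a symmetric sign matrix \<open>Q\<close> of zero diagonal, and \<open>G\<^sup>2 = G\<close>
  determines \<open>b\<close>. On a triple, \<open>Q\<close> is, up to switching signs, \<open>J - I\<close> or \<open>I - J\<close> according to the
  parity of the number of negative entries, with largest eigenvalue 2 or 1. Finally \<open>tr Q\<^sup>3\<close> is six
  times the number of even minus odd triples, and \<open>G\<^sup>2 = G\<close> yields \<open>Q\<^sup>2 = (n-1) I + \<mu> Q\<close>
  with \<open>\<mu> = (1 - 2k/n)/b\<close>, whence \<open>tr Q\<^sup>3 = \<mu> n (n-1)\<close>.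
\<close>

subsection \<open>Coordinate projections\<close>

definition coord_projection :: "'n set \<Rightarrow> real ^ 'n ^ 'n" where
  "coord_projection S = (\<chi> i j. if i = j \<and> i \<in> S then 1 else 0)"

lemma coord_projection_nth:
  "coord_projection S $ i $ j = (if i = j \<and> i \<in> S then 1 else 0)"
  by (simp add: coord_projection_def)

text \<open>Matching each matrix with its support turns the average over
  \<open>diag_projections m\<close> into one over m-element index sets.\<close>

lemma bij_betw_coord_projection:
  "bij_betw coord_projection {S :: 'n::finite set. card S = m} (diag_projections m)"
proof (rule bij_betwI[where g = "\<lambda>D. {i. D $ i $ i = 1}"])
  show "coord_projection \<in> {S :: 'n set. card S = m} \<rightarrow> diag_projections m"
    by (auto simp: diag_projections_def coord_projection_nth)
  show "(\<lambda>D. {i. D $ i $ i = 1}) \<in> diag_projections m \<rightarrow> {S :: 'n set. card S = m}"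
    by (auto simp: diag_projections_def)
  show "{i. coord_projection S $ i $ i = 1} = S" for S :: "'n set"
    by (auto simp: coord_projection_nth)
  show "coord_projection {i. D $ i $ i = 1} = D" if "D \<in> diag_projections m" for D :: "real ^ 'n ^ 'n"
  proof -
    have "D $ i $ i \<noteq> 1 \<Longrightarrow> D $ i $ i = 0" "i \<noteq> j \<Longrightarrow> D $ i $ j = 0" for i j
      using that by (auto simp: diag_projections_def)
    then show ?thesis by (simp add: vec_eq_iff coord_projection_nth) metis
  qed
qed

subsection \<open>Erasure norms as largest eigenvalues of Gram submatrices\<close>

lemma adjoint_analysis_op:
  "adjoint (analysis_op F :: real ^ 'k::finite \<Rightarrow> real ^ 'n::finite) = (\<lambda>y. \<Sum>i\<in>UNIV. y $ i *\<^sub>R F i)"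
  by (rule adjoint_unique)
    (simp add: analysis_op_def inner_vec_def[where 'b = 'n] inner_sum_right mult.commute)

text \<open>\<open>V\<^sup>* D V\<close> is the part of the frame operator made of the rank-one
  terms indexed by \<open>S\<close>.\<close>

lemma erasure_norm_coord_projection:
  "erasure_norm F (coord_projection S) = onorm (\<lambda>x. \<Sum>i\<in>S. (x \<bullet> F i) *\<^sub>R F i)"
proof -
  have "(\<Sum>i\<in>UNIV. (coord_projection S *v analysis_op F x) $ i *\<^sub>R F i) = (\<Sum>i\<in>S. (x \<bullet> F i) *\<^sub>R F i)"
    for x
  proof -
    have "(coord_projection S *v analysis_op F x) $ i = (if i \<in> S then x \<bullet> F i else 0)" for i
    proof -
      have "(coord_projection S *v analysis_op F x) $ i
              = (\<Sum>j\<in>UNIV. if j = i then (if i \<in> S then x \<bullet> F i else 0) else 0)"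
        unfolding matrix_vector_mult_def analysis_op_def
        by (simp add: coord_projection_nth if_distrib[where f = "\<lambda>z. z * _"] eq_commute[of i] cong: if_cong)
      then show ?thesis by simp
    qed
    then have "(\<Sum>i\<in>UNIV. (coord_projection S *v analysis_op F x) $ i *\<^sub>R F i)
                 = (\<Sum>i\<in>UNIV. if i \<in> S then (x \<bullet> F i) *\<^sub>R F i else 0)"
      by (intro sum.cong) auto
    then show ?thesis by (simp add: sum.If_cases)
  qed
  then show ?thesis
    by (simp add: erasure_norm_def adjoint_analysis_op o_def)
qed

text \<open>The operator and the Gram matrix of the \<open>f i\<close> have the same nonzero
  eigenvalues. So the norm can be certified on coefficient vectors: \<open>upper\<close> bounds the
  quadratic form of the Gram matrix by \<open>M\<close>, and \<open>eigen\<close> says that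
  \<open>w\<close> attains this bound.\<close>

lemma onorm_frame_operator_eqI:
  fixes f :: "'i \<Rightarrow> 'a::euclidean_space"
  assumes "finite S"
    and upper: "\<And>u. (norm (\<Sum>i\<in>S. u i *\<^sub>R f i))\<^sup>2 \<le> M * (\<Sum>i\<in>S. (u i)\<^sup>2)"
    and eigen: "\<And>i. i \<in> S \<Longrightarrow> (\<Sum>j\<in>S. w j *\<^sub>R f j) \<bullet> f i = M * w i"
    and nonzero: "\<exists>i\<in>S. w i \<noteq> 0"
    and "0 < M"
  shows "onorm (\<lambda>x. \<Sum>i\<in>S. (x \<bullet> f i) *\<^sub>R f i) = M"
proof (rule antisym)
  let ?T = "\<lambda>x. \<Sum>i\<in>S. (x \<bullet> f i) *\<^sub>R f i"
  show "onorm ?T \<le> M"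
  proof (rule onorm_bound)
    fix x
    \<comment> \<open>The coefficients are the inner products of \<open>x\<close> with the
      \<open>f i\<close>. After Cauchy-Schwarz one factor \<open>norm (?T x)\<close>
      cancels.\<close>
    have "(norm (?T x))\<^sup>2 \<le> M * (\<Sum>i\<in>S. (x \<bullet> f i)\<^sup>2)" by (rule upper)
    also have "(\<Sum>i\<in>S. (x \<bullet> f i)\<^sup>2) = x \<bullet> ?T x"
      by (simp add: inner_sum_right power2_eq_square)
    also have "M * (x \<bullet> ?T x) \<le> M * (norm x * norm (?T x))"
      using \<open>0 < M\<close> norm_cauchy_schwarz[of x "?T x"] by (intro mult_left_mono) auto
    finally have "norm (?T x) * norm (?T x) \<le> (M * norm x) * norm (?T x)"
      by (simp add: power2_eq_square algebra_simps)
    then show "norm (?T x) \<le> M * norm x"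
      using \<open>0 < M\<close> by (cases "norm (?T x) = 0") auto
  qed (use \<open>0 < M\<close> in simp)
next
  let ?T = "\<lambda>x. \<Sum>i\<in>S. (x \<bullet> f i) *\<^sub>R f i"
  \<comment> \<open>The eigenvector \<open>w\<close> of the Gram matrix is carried to an eigenvector
    \<open>x\<close> of \<open>?T\<close>. It is nonzero because its squared norm is
    \<open>M\<close> times that of \<open>w\<close>.\<close>
  define x where "x = (\<Sum>j\<in>S. w j *\<^sub>R f j)"
  have "x \<bullet> x = (\<Sum>i\<in>S. w i * (x \<bullet> f i))"
    by (subst (2) x_def) (simp add: inner_sum_right)
  also have "\<dots> = M * (\<Sum>i\<in>S. (w i)\<^sup>2)"
    using eigen by (simp add: x_def sum_distrib_left power2_eq_square algebra_simps)
  also have "\<dots> > 0"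
  proof -
    from nonzero obtain i where "i \<in> S" "w i \<noteq> 0" by auto
    then have "(\<Sum>i\<in>S. (w i)\<^sup>2) > 0"
      using \<open>finite S\<close> by (intro sum_pos2[of S i]) auto
    then show ?thesis using \<open>0 < M\<close> by simp
  qed
  finally have "0 < norm x" by auto
  have "?T x = M *\<^sub>R x"
    using eigen by (simp add: x_def scaleR_sum_right)
  moreover have "bounded_linear ?T"
    by (intro bounded_linear_sum bounded_linear_scaleR_const bounded_linear_inner_left)
  then have "norm (?T x) \<le> onorm ?T * norm x" by (rule onorm)
  ultimately show "M \<le> onorm ?T"
    using \<open>0 < norm x\<close> \<open>0 < M\<close> by simp
qed

lemma norm_add_power2: "(norm (x + y))\<^sup>2 = x \<bullet> x + y \<bullet> y + 2 * (x \<bullet> y)"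
  for x y :: "'a::real_inner"
  by (simp add: power2_norm_eq_inner inner_add_left inner_add_right inner_commute)

text \<open>The Gram matrix has diagonal a and off-diagonal entry g =
  \<open>f i \<bullet> f j\<close>, hence eigenvalues a + g and a - g. The witness is (1, 1) or (1,
  -1), according to the sign of g.\<close>

lemma onorm_frame_operator_pair:
  fixes f :: "'i \<Rightarrow> 'a::euclidean_space"
  assumes "i \<noteq> j" "f i \<bullet> f i = a" "f j \<bullet> f j = a" "0 < a"
  shows "onorm (\<lambda>x. \<Sum>l\<in>{i, j}. (x \<bullet> f l) *\<^sub>R f l) = a + \<bar>f i \<bullet> f j\<bar>"
proof (rule onorm_frame_operator_eqI[where w = "\<lambda>l. if l = i \<or> 0 \<le> f i \<bullet> f j then 1 else -1"])
  fix u
  have "2 * (f i \<bullet> f j) * (u i * u j) \<le> \<bar>f i \<bullet> f j\<bar> * ((u i)\<^sup>2 + (u j)\<^sup>2)"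
  proof -
    have "(f i \<bullet> f j) * (u i * u j) \<le> \<bar>f i \<bullet> f j\<bar> * \<bar>u i * u j\<bar>"
      by (metis abs_ge_self abs_mult)
    moreover have "2 * \<bar>u i * u j\<bar> \<le> (u i)\<^sup>2 + (u j)\<^sup>2"
      using sum_squares_bound[of "\<bar>u i\<bar>" "\<bar>u j\<bar>"] by (simp add: abs_mult)
    then have "\<bar>f i \<bullet> f j\<bar> * (2 * \<bar>u i * u j\<bar>) \<le> \<bar>f i \<bullet> f j\<bar> * ((u i)\<^sup>2 + (u j)\<^sup>2)"
      by (intro mult_left_mono) auto
    ultimately show ?thesis by linarith
  qed
  then show "(norm (\<Sum>l\<in>{i, j}. u l *\<^sub>R f l))\<^sup>2 \<le> (a + \<bar>f i \<bullet> f j\<bar>) * (\<Sum>l\<in>{i, j}. (u l)\<^sup>2)"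
    using assms by (simp add: norm_add_power2) (simp add: algebra_simps power2_eq_square)
qed (use assms in \<open>auto simp: inner_add_left inner_diff_left inner_commute[of "f j" "f i"]\<close>)

lemma norm_add3_power2:
  "(norm (x + (y + z)))\<^sup>2 = x \<bullet> x + y \<bullet> y + z \<bullet> z + 2 * (x \<bullet> y + x \<bullet> z + y \<bullet> z)"
  for x y z :: "'a::real_inner"
  by (simp add: power2_norm_eq_inner inner_add_left inner_add_right inner_commute)

text \<open>The three signs have product 1, so with w = (1, s, t) the Gram matrix is (a - b) I + b w
  w^T. Its largest eigenvalue a - b + 3b belongs to w.\<close>

lemma onorm_frame_operator_even_triple:
  fixes f :: "'i \<Rightarrow> 'a::euclidean_space"
  assumes "i \<noteq> j" "i \<noteq> l" "j \<noteq> l" "0 < a" "0 \<le> b"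
    and "f i \<bullet> f i = a" "f j \<bullet> f j = a" "f l \<bullet> f l = a"
    and "f i \<bullet> f j = b * s" "f i \<bullet> f l = b * t" "f j \<bullet> f l = b * (s * t)"
    and "s\<^sup>2 = 1" "t\<^sup>2 = 1"
  shows "onorm (\<lambda>x. \<Sum>m\<in>{i, j, l}. (x \<bullet> f m) *\<^sub>R f m) = a + 2 * b"
proof (rule onorm_frame_operator_eqI[where w = "\<lambda>m. if m = i then 1 else if m = j then s else t"])
  fix u
  have "(norm (\<Sum>m\<in>{i, j, l}. u m *\<^sub>R f m))\<^sup>2 = a * ((u i)\<^sup>2 + (u j)\<^sup>2 + (u l)\<^sup>2)
          + 2 * b * (s * (u i * u j) + t * (u i * u l) + s * t * (u j * u l))"
    using assms by (simp add: norm_add3_power2) (simp add: power2_eq_square algebra_simps)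
  \<comment> \<open>Lagrange's identity: the gap is b times |w|^2 |u|^2 - (w . u)^2, the sum of the
    squared 2 by 2 minors of w and u.\<close>
  then have "(a + 2 * b) * ((u i)\<^sup>2 + ((u j)\<^sup>2 + (u l)\<^sup>2)) - (norm (\<Sum>m\<in>{i, j, l}. u m *\<^sub>R f m))\<^sup>2
          = b * ((s * u i - u j)\<^sup>2 + (t * u i - u l)\<^sup>2 + (t * u j - s * u l)\<^sup>2)"
    by (simp add: power2_diff power_mult_distrib \<open>s\<^sup>2 = 1\<close> \<open>t\<^sup>2 = 1\<close> algebra_simps)
  moreover have "\<dots> \<ge> 0" using \<open>0 \<le> b\<close> by simp
  ultimately show "(norm (\<Sum>m\<in>{i, j, l}. u m *\<^sub>R f m))\<^sup>2 \<le> (a + 2 * b) * (\<Sum>m\<in>{i, j, l}. (u m)\<^sup>2)"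
    using \<open>i \<noteq> j\<close> \<open>i \<noteq> l\<close> \<open>j \<noteq> l\<close> by simp
next
  have "f j \<bullet> f i = b * s" "f l \<bullet> f i = b * t" "f l \<bullet> f j = b * (s * t)"
    using assms by (simp_all add: inner_commute)
  moreover have square: "s * s = 1" "t * t = 1" "s * (s * x) = x" "t * (t * x) = x" for x
    using assms by (simp_all add: power2_eq_square flip: mult.assoc)
  moreover fix m assume "m \<in> {i, j, l}"
  ultimately show "(\<Sum>m\<in>{i, j, l}. (if m = i then 1 else if m = j then s else t) *\<^sub>R f m) \<bullet> f m
       = (a + 2 * b) * (if m = i then 1 else if m = j then s else t)"
    using assms by (auto simp: inner_add_left algebra_simps square)
qed (use assms in auto)

text \<open>Here the signs have product -1, and with z = (1, -s, -t) the Gram matrix is (a + b) I -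
  b z z^T. Its largest eigenvalue a + b belongs to the plane orthogonal to z, which contains the
  witness (1, s, 0). The gap in the upper bound is b (z . u)^2.\<close>

lemma onorm_frame_operator_odd_triple:
  fixes f :: "'i \<Rightarrow> 'a::euclidean_space"
  assumes "i \<noteq> j" "i \<noteq> l" "j \<noteq> l" "0 < a" "0 \<le> b"
    and "f i \<bullet> f i = a" "f j \<bullet> f j = a" "f l \<bullet> f l = a"
    and "f i \<bullet> f j = b * s" "f i \<bullet> f l = b * t" "f j \<bullet> f l = - (b * (s * t))"
    and "s\<^sup>2 = 1" "t\<^sup>2 = 1"
  shows "onorm (\<lambda>x. \<Sum>m\<in>{i, j, l}. (x \<bullet> f m) *\<^sub>R f m) = a + b"
proof (rule onorm_frame_operator_eqI[where w = "\<lambda>m. if m = i then 1 else if m = j then s else 0"])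
  fix u
  have "(norm (\<Sum>m\<in>{i, j, l}. u m *\<^sub>R f m))\<^sup>2 = a * ((u i)\<^sup>2 + (u j)\<^sup>2 + (u l)\<^sup>2)
          + 2 * b * (s * (u i * u j) + t * (u i * u l) - s * t * (u j * u l))"
    using assms by (simp add: norm_add3_power2) (simp add: power2_eq_square algebra_simps)
  then have "(a + b) * ((u i)\<^sup>2 + ((u j)\<^sup>2 + (u l)\<^sup>2)) - (norm (\<Sum>m\<in>{i, j, l}. u m *\<^sub>R f m))\<^sup>2
          = b * (u i - s * u j - t * u l)\<^sup>2"
    by (simp add: diff_diff_eq power2_diff power2_sum power_mult_distrib \<open>s\<^sup>2 = 1\<close> \<open>t\<^sup>2 = 1\<close> algebra_simps)
  moreover have "\<dots> \<ge> 0" using \<open>0 \<le> b\<close> by simp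
  ultimately show "(norm (\<Sum>m\<in>{i, j, l}. u m *\<^sub>R f m))\<^sup>2 \<le> (a + b) * (\<Sum>m\<in>{i, j, l}. (u m)\<^sup>2)"
    using \<open>i \<noteq> j\<close> \<open>i \<noteq> l\<close> \<open>j \<noteq> l\<close> by simp
next
  have "f j \<bullet> f i = b * s" "f l \<bullet> f i = b * t" "f l \<bullet> f j = - (b * (s * t))"
    using assms by (simp_all add: inner_commute)
  moreover have square: "s * s = 1" "t * t = 1" "s * (s * x) = x" "t * (t * x) = x" for x
    using assms by (simp_all add: power2_eq_square flip: mult.assoc)
  moreover fix m assume "m \<in> {i, j, l}"
  ultimately show "(\<Sum>m\<in>{i, j, l}. (if m = i then 1 else if m = j then s else 0) *\<^sub>R f m) \<bullet> f m
       = (a + b) * (if m = i then 1 else if m = j then s else 0)"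
    using assms by (auto simp: inner_add_left algebra_simps square)
qed (use assms in auto)

subsection \<open>The Gram matrix of a Parseval frame\<close>

text \<open>Polarization of the Parseval identity. Applied to frame vectors it says that the Gram
  matrix is idempotent.\<close>

lemma parseval_frame_inner:
  assumes "parseval_frame F"
  shows "x \<bullet> y = (\<Sum>j\<in>UNIV. (x \<bullet> F j) * (F j \<bullet> y))"
proof -
  have sq: "z \<bullet> z = (\<Sum>j\<in>UNIV. (z \<bullet> F j)\<^sup>2)" for z
    using assms by (simp add: parseval_frame_def power2_norm_eq_inner)
  have "2 * (x \<bullet> y) = (x + y) \<bullet> (x + y) - x \<bullet> x - y \<bullet> y"
    by (simp add: inner_add_left inner_add_right inner_commute)
  also have "\<dots> = (\<Sum>j\<in>UNIV. ((x + y) \<bullet> F j)\<^sup>2 - (x \<bullet> F j)\<^sup>2 - (y \<bullet> F j)\<^sup>2)"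
    by (simp add: sq sum_subtractf)
  also have "\<dots> = (\<Sum>j\<in>UNIV. 2 * ((x \<bullet> F j) * (F j \<bullet> y)))"
    by (intro sum.cong)
      (auto simp: inner_add_left power2_eq_square algebra_simps inner_commute)
  finally show ?thesis by (simp add: sum_distrib_left[symmetric])
qed

text \<open>Summing the squared coordinates of all frame vectors one basis direction at a time, each
  direction contributes 1 by the Parseval identity.\<close>

lemma parseval_frame_trace:
  fixes F :: "'n::finite \<Rightarrow> real ^ 'k::finite"
  assumes "parseval_frame F"
  shows "(\<Sum>i\<in>UNIV. F i \<bullet> F i) = real CARD('k)"
proof -
  have "(\<Sum>i\<in>UNIV. F i \<bullet> F i) = (\<Sum>i\<in>UNIV. \<Sum>b\<in>Basis. (b \<bullet> F i)\<^sup>2)"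
    by (intro sum.cong refl, subst euclidean_inner) (simp add: power2_eq_square inner_commute)
  also have "\<dots> = (\<Sum>b\<in>Basis. \<Sum>i\<in>UNIV. (b \<bullet> F i)\<^sup>2)"
    by (rule sum.swap)
  also have "\<dots> = (\<Sum>b\<in>(Basis :: (real ^ 'k) set). (norm b)\<^sup>2)"
    using assms unfolding parseval_frame_def power2_abs by (intro sum.cong refl) metis
  also have "\<dots> = real CARD('k)" by simp
  finally show ?thesis .
qed

subsection \<open>Triples\<close>

lemma even_card_induced_edges_triple:
  assumes "i \<noteq> j" "i \<noteq> l" "j \<noteq> l"
  shows "even (card (induced_edges F {i, j, l}))
           \<longleftrightarrow> even (of_bool (F i \<bullet> F j < 0) + of_bool (F i \<bullet> F l < 0) + of_bool (F j \<bullet> F l < 0) :: nat)"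
proof -
  have "induced_edges F {i, j, l} = (if F i \<bullet> F j < 0 then {{i, j}} else {})
      \<union> (if F i \<bullet> F l < 0 then {{i, l}} else {}) \<union> (if F j \<bullet> F l < 0 then {{j, l}} else {})"
    using assms unfolding induced_edges_def frame_adj_def
    by (auto simp: inner_commute insert_commute)
  then show ?thesis
    using assms by (auto simp: doubleton_eq_iff card_insert_if)
qed

lemma card_orderings_of_triple:
  assumes "card S = 3"
  shows "card {(i, j, l). i \<noteq> j \<and> i \<noteq> l \<and> j \<noteq> l \<and> {i, j, l} = S} = 6"
proof -
  from assms obtain a b c where S: "S = {a, b, c}" and "a \<noteq> b" "b \<noteq> c" "a \<noteq> c"
    by (auto simp: card_3_iff)
  have "(i \<noteq> j \<and> i \<noteq> l \<and> j \<noteq> l \<and> {i, j, l} = S)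
      \<longleftrightarrow> (i, j, l) \<in> {(a, b, c), (a, c, b), (b, a, c), (b, c, a), (c, a, b), (c, b, a)}"
    for i j l
  proof
    assume *: "i \<noteq> j \<and> i \<noteq> l \<and> j \<noteq> l \<and> {i, j, l} = S"
    then have "i \<in> {a, b, c}" "j \<in> {a, b, c}" "l \<in> {a, b, c}" unfolding S by blast+
    with * show "(i, j, l) \<in> {(a, b, c), (a, c, b), (b, a, c), (b, c, a), (c, a, b), (c, b, a)}"
      by auto
  next
    assume "(i, j, l) \<in> {(a, b, c), (a, c, b), (b, a, c), (b, c, a), (c, a, b), (c, b, a)}"
    then show "i \<noteq> j \<and> i \<noteq> l \<and> j \<noteq> l \<and> {i, j, l} = S"
      unfolding S using \<open>a \<noteq> b\<close> \<open>b \<noteq> c\<close> \<open>a \<noteq> c\<close> by auto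
  qed
  then have "{(i, j, l). i \<noteq> j \<and> i \<noteq> l \<and> j \<noteq> l \<and> {i, j, l} = S}
      = {(a, b, c), (a, c, b), (b, a, c), (b, c, a), (c, a, b), (c, b, a)}"
    by (intro equalityI subrelI) (simp_all only: split_paired_all mem_Collect_eq prod.case)
  then show ?thesis
    using \<open>a \<noteq> b\<close> \<open>b \<noteq> c\<close> \<open>a \<noteq> c\<close> by simp
qed

text \<open>Ordered triples are grouped by their underlying set, and each 3-element set has six
  orderings. This converts the trace of a cubed matrix into a count of triples.\<close>

lemma sum_ordered_triples:
  fixes h :: "'n::finite set \<Rightarrow> real"
  shows "(\<Sum>(i, j, l)\<in>{(i, j, l). i \<noteq> j \<and> i \<noteq> l \<and> j \<noteq> l}. h {i, j, l}) = 6 * (\<Sum>S | card S = 3. h S)"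
proof -
  let ?P = "{(i, j, l). i \<noteq> j \<and> i \<noteq> l \<and> j \<noteq> l} :: ('n \<times> 'n \<times> 'n) set"
  let ?set = "\<lambda>(i, j, l). {i, j, l} :: 'n set"
  have "(\<Sum>x\<in>?P. h (?set x)) = (\<Sum>S | card S = 3. \<Sum>x\<in>{x \<in> ?P. ?set x = S}. h (?set x))"
    by (rule sum.group[symmetric]) auto
  also have "\<dots> = (\<Sum>S | card S = 3. 6 * h S)"
  proof (intro sum.cong refl)
    fix S :: "'n set" assume "S \<in> {S. card S = 3}"
    moreover have "{x \<in> ?P. ?set x = S} = {(i, j, l). i \<noteq> j \<and> i \<noteq> l \<and> j \<noteq> l \<and> {i, j, l} = S}"
      by auto
    ultimately show "(\<Sum>x\<in>{x \<in> ?P. ?set x = S}. h (?set x)) = 6 * h S"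
      using card_orderings_of_triple[of S] by (simp add: case_prod_unfold)
  qed
  finally show ?thesis
    by (simp add: sum_distrib_left case_prod_unfold)
qed

lemma even_triples_add_odd_triples:
  fixes F :: "'n::finite \<Rightarrow> real ^ 'k::finite"
  shows "even_triples F + odd_triples F = CARD('n) choose 3"
proof -
  have "even_triples F + odd_triples F
      = card ({S. card S = 3 \<and> even (card (induced_edges F S))} \<union> {S. card S = 3 \<and> odd (card (induced_edges F S))})"
    unfolding even_triples_def odd_triples_def by (rule card_Un_disjoint[symmetric]) auto
  also have "\<dots> = card {S :: 'n set. S \<subseteq> UNIV \<and> card S = 3}"
    by (rule arg_cong[where f = card]) auto
  finally show ?thesis
    by (simp only: n_subsets[OF finite])
qed

lemma sum_triples_by_parity:
  fixes F :: "'n::finite \<Rightarrow> real ^ 'k::finite" and x y :: real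
  shows "(\<Sum>S | card S = 3. if even (card (induced_edges F S)) then x else y)
           = x * real (even_triples F) + y * real (odd_triples F)"
  by (simp add: sum.If_cases even_triples_def odd_triples_def Int_def Collect_neg_eq[symmetric])

subsection \<open>Equiangular Parseval frames\<close>

text \<open>The values of \<open>a\<close> and \<open>b\<close> are irrelevant to the counting and
  are inserted only at the end. Positivity of \<open>b\<close> makes all off-diagonal signs nonzero
  and allows \<open>b\<close> to be cancelled.\<close>

locale equiangular_parseval_frame =
  fixes F :: "'n::finite \<Rightarrow> real ^ 'k::finite" and a b :: real
  assumes parseval: "parseval_frame F"
    and norm_square: "\<And>i. F i \<bullet> F i = a"
    and abs_inner: "\<And>i j. i \<noteq> j \<Longrightarrow> \<bar>F i \<bullet> F j\<bar> = b"
    and a_pos: "0 < a"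
    and b_pos: "0 < b"
begin

text \<open>The matrix Q. It is the Seidel matrix of the graph of \<open>frame_adj\<close>: -1 on
  edges, 1 on non-edges, 0 on the diagonal.\<close>

definition sign :: "'n \<Rightarrow> 'n \<Rightarrow> real" where
  "sign i j = (if i = j then 0 else sgn (F i \<bullet> F j))"

lemma inner_eq: "F i \<bullet> F j = (if i = j then a else 0) + b * sign i j"
  using norm_square[of i] abs_inner[of i j] by (auto simp: sign_def sgn_if)

lemma sign_square: "i \<noteq> j \<Longrightarrow> (sign i j)\<^sup>2 = 1"
  using abs_inner[of i j] b_pos by (auto simp: sign_def sgn_if)

lemma sign_commute: "sign i j = sign j i"
  by (simp add: sign_def inner_commute)

lemma sign_product:
  assumes "i \<noteq> j" "i \<noteq> l" "j \<noteq> l"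
  shows "sign i j * sign j l * sign l i = (if even (card (induced_edges F {i, j, l})) then 1 else -1)"
  unfolding even_card_induced_edges_triple[OF assms]
  using assms abs_inner[of i j] abs_inner[of i l] abs_inner[of j l] b_pos inner_commute[of "F l" "F i"]
  by (auto simp: sign_def sgn_if)

lemma erasure_norm_triple:
  assumes "card S = 3"
  shows "erasure_norm F (coord_projection S)
           = (if even (card (induced_edges F S)) then a + 2 * b else a + b)"
proof -
  from assms obtain i j l where S: "S = {i, j, l}" and ne: "i \<noteq> j" "i \<noteq> l" "j \<noteq> l"
    by (auto simp: card_3_iff)
  have sq: "(sign i j)\<^sup>2 = 1" "(sign i l)\<^sup>2 = 1"
    using ne by (simp_all add: sign_square)
  have prod: "sign i j * sign j l * sign i l = (if even (card (induced_edges F S)) then 1 else -1)"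
    using sign_product[OF ne] by (simp add: sign_commute S)
  \<comment> \<open>Inserting squares equal to 1 recovers the third sign from the other two and the
    parity, which is the form assumed by the two triple lemmas.\<close>
  have "sign j l = (sign i j)\<^sup>2 * (sign i l)\<^sup>2 * sign j l"
    by (simp only: sq mult_1)
  also have "\<dots> = (sign i j * sign j l * sign i l) * (sign i j * sign i l)"
    by (simp only: power2_eq_square ac_simps)
  finally have jl: "sign j l = (if even (card (induced_edges F S)) then 1 else -1) * (sign i j * sign i l)"
    by (simp only: prod)
  have ip: "F i \<bullet> F j = b * sign i j" "F i \<bullet> F l = b * sign i l"
    using ne by (simp_all add: inner_eq)
  show ?thesis
  proof (cases "even (card (induced_edges F S))")
    case True
    with jl have "F j \<bullet> F l = b * (sign i j * sign i l)"
      using ne by (simp add: inner_eq)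
    from onorm_frame_operator_even_triple[OF ne a_pos _ norm_square norm_square norm_square ip this sq]
    show ?thesis
      using b_pos True by (simp only: erasure_norm_coord_projection S) simp
  next
    case False
    with jl have "F j \<bullet> F l = - (b * (sign i j * sign i l))"
      using ne by (simp add: inner_eq)
    from onorm_frame_operator_odd_triple[OF ne a_pos _ norm_square norm_square norm_square ip this sq]
    show ?thesis
      using b_pos False by (simp only: erasure_norm_coord_projection S) simp
  qed
qed

lemma sum_erasure_norm_triples:
  "(\<Sum>D\<in>diag_projections 3. erasure_norm F D powr p)
     = (a + 2 * b) powr p * real (even_triples F) + (a + b) powr p * real (odd_triples F)"
proof -
  have "(\<Sum>D\<in>diag_projections 3. erasure_norm F D powr p)
      = (\<Sum>S | card S = 3. erasure_norm F (coord_projection S) powr p)"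
    by (rule sum.reindex_bij_betw[OF bij_betw_coord_projection, symmetric])
  also have "\<dots> = (\<Sum>S | card S = 3. if even (card (induced_edges F S)) then (a + 2 * b) powr p
                     else (a + b) powr p)"
    by (intro sum.cong) (auto simp: erasure_norm_triple)
  finally show ?thesis by (simp only: sum_triples_by_parity)
qed

lemma sum_sign_square: "(\<Sum>j\<in>UNIV. (sign i j)\<^sup>2) = real CARD('n) - 1"
proof -
  have "(\<Sum>j\<in>UNIV. (sign i j)\<^sup>2) = (\<Sum>j\<in>UNIV - {i}. (sign i j)\<^sup>2)"
    by (subst sum.remove[of UNIV i]) (auto simp: sign_def)
  also have "\<dots> = (\<Sum>j\<in>UNIV - {i}. 1)"
    by (intro sum.cong) (auto simp: sign_square)
  finally show ?thesis by (simp add: card_Diff_singleton of_nat_diff Suc_leI)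
qed

text \<open>The entries of (a I + b Q)^2 = a I + b Q, solved for the quadratic term.\<close>

lemma sign_matrix_square:
  "b\<^sup>2 * (\<Sum>j\<in>UNIV. sign i j * sign j l)
     = (if i = l then a - a\<^sup>2 else 0) + (b - 2 * a * b) * sign i l"
proof -
  have "F i \<bullet> F l = (\<Sum>j\<in>UNIV. (F i \<bullet> F j) * (F j \<bullet> F l))"
    by (rule parseval_frame_inner[OF parseval])
  \<comment> \<open>The identity part of each factor contributes only at j = i or j = l; the
    conditionals isolate these terms so that they sum to closed forms.\<close>
  also have "\<dots> = (\<Sum>j\<in>UNIV. (if j = i then (if i = l then a\<^sup>2 else 0) else 0) + (if j = i then a * b * sign i l else 0)
        + (if j = l then a * b * sign i l else 0) + b\<^sup>2 * (sign i j * sign j l))"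
    by (intro sum.cong) (auto simp: inner_eq power2_eq_square algebra_simps)
  also have "\<dots> = (if i = l then a\<^sup>2 else 0) + 2 * a * b * sign i l + b\<^sup>2 * (\<Sum>j\<in>UNIV. sign i j * sign j l)"
    by (simp add: sum.distrib sum_distrib_left)
  finally show ?thesis
    by (auto simp: inner_eq algebra_simps)
qed

text \<open>The left side is tr Q^3. The zero diagonal kills index triples with a repetition; every
  other one contributes 1 or -1 by parity.\<close>

lemma sum_sign_triangles:
  "(\<Sum>i\<in>UNIV. \<Sum>l\<in>UNIV. \<Sum>j\<in>UNIV. sign i j * sign j l * sign l i)
     = 6 * (real (even_triples F) - real (odd_triples F))"
proof -
  let ?g = "\<lambda>(i, j, l). sign i j * sign j l * sign l i"
  have "(\<Sum>i\<in>UNIV. \<Sum>l\<in>UNIV. \<Sum>j\<in>UNIV. sign i j * sign j l * sign l i)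
      = (\<Sum>i\<in>UNIV. \<Sum>j\<in>UNIV. \<Sum>l\<in>UNIV. sign i j * sign j l * sign l i)"
    by (intro sum.cong refl sum.swap)
  also have "\<dots> = (\<Sum>x\<in>UNIV. ?g x)"
    by (simp add: sum.cartesian_product)
  also have "\<dots> = (\<Sum>x\<in>{(i, j, l). i \<noteq> j \<and> i \<noteq> l \<and> j \<noteq> l}. ?g x)"
    by (rule sum.mono_neutral_right) (auto simp: sign_def)
  also have "\<dots> = (\<Sum>(i, j, l)\<in>{(i, j, l). i \<noteq> j \<and> i \<noteq> l \<and> j \<noteq> l}.
                     if even (card (induced_edges F {i, j, l})) then 1 else -1)"
    by (intro sum.cong refl) (auto simp: sign_product)
  also have "\<dots> = 6 * (\<Sum>S | card S = 3. if even (card (induced_edges F S)) then 1 else -1)"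
    by (rule sum_ordered_triples)
  finally show ?thesis by (simp add: sum_triples_by_parity)
qed

text \<open>Evaluates tr Q^3 a second time, as tr (Q^2 Q). The identity part of Q^2 drops out
  because Q has zero diagonal, and the rest is a multiple of tr Q^2 = n (n - 1).\<close>

lemma even_minus_odd_triples:
  "6 * b * (real (even_triples F) - real (odd_triples F))
     = (1 - 2 * a) * real CARD('n) * (real CARD('n) - 1)"
proof -
  have "b\<^sup>2 * (6 * (real (even_triples F) - real (odd_triples F)))
      = (\<Sum>i\<in>UNIV. \<Sum>l\<in>UNIV. (b\<^sup>2 * (\<Sum>j\<in>UNIV. sign i j * sign j l)) * sign l i)"
    unfolding sum_sign_triangles[symmetric] by (simp add: sum_distrib_left sum_distrib_right mult.assoc)
  also have "\<dots> = (\<Sum>i\<in>UNIV. \<Sum>l\<in>UNIV. (b - 2 * a * b) * (sign i l)\<^sup>2)"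
    unfolding sign_matrix_square
    by (intro sum.cong refl) (auto simp: sign_def power2_eq_square algebra_simps inner_commute)
  also have "\<dots> = b * ((1 - 2 * a) * real CARD('n) * (real CARD('n) - 1))"
    by (simp only: sum_distrib_left[symmetric] sum_sign_square) (simp add: algebra_simps)
  finally have "b * (6 * b * (real (even_triples F) - real (odd_triples F)))
      = b * ((1 - 2 * a) * real CARD('n) * (real CARD('n) - 1))"
    by (simp only: power2_eq_square ac_simps)
  then show ?thesis
    using b_pos by simp
qed

end

section \<open>From 2-uniformity to equiangularity\<close>

text \<open>Equal norms and the trace k force a = k/n. Equal pair norms a + |g| force a common
  modulus b, which the diagonal of G^2 = G determines; k < n makes it positive.\<close>

lemma two_uniform_equiangular:
  fixes F :: "'n::finite \<Rightarrow> real ^ 'k::finite"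
  assumes "parseval_frame F" "two_uniform_frame F" "CARD('k) < CARD('n)"
  shows "equiangular_parseval_frame F (real CARD('k) / real CARD('n))
           (equiangular_const CARD('n) CARD('k))"
proof -
  let ?n = "real CARD('n)" and ?k = "real CARD('k)"
  define a where "a = ?k / ?n"
  have kn: "0 < ?k" "?k < ?n" "1 < ?n"
    using assms(3) zero_less_card_finite[where 'a = 'k] by (simp_all del: zero_less_card_finite)
  have "\<exists>i j :: 'n. i \<noteq> j"
  proof (rule ccontr)
    assume "\<not> ?thesis"
    then have "CARD('n) \<le> 1" by (simp add: card_le_Suc0_iff_eq)
    then show False using kn by simp
  qed
  then obtain i0 j0 :: 'n where ne0: "i0 \<noteq> j0" by blast
  have a: "0 < a" "a < 1" using kn by (auto simp: a_def)
  have norm_square: "F i \<bullet> F i = a" for i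
  proof -
    have "F j \<bullet> F j = F i \<bullet> F i" for j
      using assms(2) by (metis power2_norm_eq_inner two_uniform_frame_def uniform_frame_def)
    then have "(\<Sum>j\<in>UNIV. F j \<bullet> F j) = (\<Sum>j\<in>(UNIV :: 'n set). F i \<bullet> F i)"
      by (intro sum.cong refl)
    then have "?n * (F i \<bullet> F i) = ?k"
      using parseval_frame_trace[OF assms(1)] by simp
    then show ?thesis using kn by (simp add: a_def field_simps)
  qed
  have pair: "erasure_norm F (coord_projection {i, j}) = a + \<bar>F i \<bullet> F j\<bar>"
    and diag: "coord_projection {i, j} \<in> diag_projections 2" if "i \<noteq> j" for i j
    using that onorm_frame_operator_pair[of i j F a] norm_square a
      bij_betw_apply[OF bij_betw_coord_projection, of "{i, j}" 2]
    by (auto simp only: erasure_norm_coord_projection mem_Collect_eq card_2_iff)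
  define b where "b = \<bar>F i0 \<bullet> F j0\<bar>"
  have abs_inner: "\<bar>F i \<bullet> F j\<bar> = b" if "i \<noteq> j" for i j
    using assms(2) pair[OF that] pair[OF ne0] diag[OF that] diag[OF ne0]
    unfolding two_uniform_frame_def b_def by (metis add_left_cancel)
  \<comment> \<open>A diagonal entry of G^2 = G, giving a = a^2 + (n - 1) b^2.\<close>
  have "a = (\<Sum>j\<in>UNIV. (F i0 \<bullet> F j) * (F j \<bullet> F i0))"
    using norm_square[of i0] parseval_frame_inner[OF assms(1)] by metis
  also have "\<dots> = a\<^sup>2 + (\<Sum>j\<in>UNIV - {i0}. (F i0 \<bullet> F j) * (F j \<bullet> F i0))"
    by (subst sum.remove[of UNIV i0]) (auto simp: norm_square power2_eq_square)
  also have "(\<Sum>j\<in>UNIV - {i0}. (F i0 \<bullet> F j) * (F j \<bullet> F i0)) = (\<Sum>j\<in>UNIV - {i0}. b\<^sup>2)"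
  proof (intro sum.cong refl)
    fix j assume "j \<in> UNIV - {i0}"
    then have "b\<^sup>2 = (F i0 \<bullet> F j)\<^sup>2" using abs_inner[of i0 j] by auto
    then show "(F i0 \<bullet> F j) * (F j \<bullet> F i0) = b\<^sup>2"
      by (simp add: power2_eq_square inner_commute)
  qed
  also have "\<dots> = (?n - 1) * b\<^sup>2"
    by (simp add: card_Diff_singleton of_nat_diff Suc_leI)
  finally have "b\<^sup>2 = (a - a\<^sup>2) / (?n - 1)"
    using kn by (simp add: field_simps)
  also have "\<dots> = ?k * (?n - ?k) / (?n\<^sup>2 * (?n - 1))"
    using kn by (simp add: a_def field_simps power2_eq_square)
  finally have b: "b = equiangular_const CARD('n) CARD('k)"
    unfolding equiangular_const_def by (metis abs_ge_zero b_def real_sqrt_unique)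
  moreover have "0 < b"
    unfolding b equiangular_const_def using kn by simp
  ultimately show ?thesis
    using assms(1) norm_square abs_inner a
    unfolding equiangular_parseval_frame_def a_def by auto
qed

section \<open>Eliminating the square roots from v and c\<close>

text \<open>In terms of \<open>s\<close> and \<open>t\<close>, the square roots in the formulas for \<open>v\<close> and \<open>c\<close>, one has \<open>s t = n - 1\<close>
  and \<open>b (s - t) = 1 - 2k/n\<close>; hence \<open>c = (3v - n)/2\<close>.\<close>

lemma triangle_count_formula:
  fixes n k v c :: real
  assumes "0 < k" "k < n" "1 < n"
    and b: "b = sqrt (k * (n - k) / (n\<^sup>2 * (n - 1)))"
    and v: "v = 1/2 * (n - 2 - sqrt ((n - k) * (n - 1) / k) + sqrt (k * (n - 1) / (n - k)))"
    and c: "c = v - 1 - 1/4 * (sqrt ((n - k) * (n - 1) / k) - 1) * (sqrt (k * (n - 1) / (n - k)) + 1)"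
  shows "b * (n - 2 - 2 * v) = 1 - 2 * (k / n)"
    and "v * (n - 1) * c / 6 + (n - 2 * v + c) * ((n - 1) * v / 2) = n * (n - 1) * v / 6"
proof -
  define s where "s = sqrt ((n - k) * (n - 1) / k)"
  define t where "t = sqrt (k * (n - 1) / (n - k))"
  \<comment> \<open>Each of the products s t, b s and b t is the root of a perfect square, so the
    square roots disappear.\<close>
  have "s * t = sqrt ((n - 1)\<^sup>2)"
    unfolding s_def t_def real_sqrt_mult[symmetric] using assms(1-3)
    by (intro arg_cong[where f = sqrt]) (simp add: field_simps power2_eq_square)
  then have st: "s * t = n - 1" using assms(3) by simp
  have "b * s = sqrt (((n - k) / n)\<^sup>2)"
    unfolding b s_def real_sqrt_mult[symmetric] using assms(1-3)
    by (intro arg_cong[where f = sqrt]) (simp add: divide_simps power2_eq_square)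
  then have bs: "b * s = (n - k) / n" using assms(1-3) by simp
  have "b * t = sqrt ((k / n)\<^sup>2)"
    unfolding b t_def real_sqrt_mult[symmetric] using assms(1-3)
    by (intro arg_cong[where f = sqrt]) (simp add: divide_simps power2_eq_square)
  then have bt: "b * t = k / n" using assms(1-3) by simp
  have v': "v = (n - 2 - s + t) / 2" using v by (simp add: s_def t_def)
  have "n - 2 - 2 * v = s - t" by (simp add: v' field_simps)
  then have "b * (n - 2 - 2 * v) = b * s - b * t" by (simp add: right_diff_distrib)
  also have "\<dots> = 1 - 2 * (k / n)"
    unfolding bs bt using assms(1-3) by (simp add: field_simps)
  finally show "b * (n - 2 - 2 * v) = 1 - 2 * (k / n)" .
  have "4 * c = 4 * v - 4 - (s * t + s - t - 1)"
    unfolding c s_def[symmetric] t_def[symmetric]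
    by (simp add: algebra_simps add_divide_distrib diff_divide_distrib)
  also have "\<dots> = 6 * v - 2 * n" by (simp add: st v' field_simps)
  finally have c': "c = (3 * v - n) / 2" by simp
  \<comment> \<open>Since n - 2v + c = (n - v)/2, the terms quadratic in v cancel.\<close>
  show "v * (n - 1) * c / 6 + (n - 2 * v + c) * ((n - 1) * v / 2) = n * (n - 1) * v / 6"
    unfolding c' by (simp add: field_simps)
qed

lemma real_choose_3:
  assumes "3 \<le> n"
  shows "real (n choose 3) = real n * (real n - 1) * (real n - 2) / 6"
proof -
  have "real (n choose 3) = (\<Prod>i = 0..<3. real n - real i) / fact 3"
    by (simp add: binomial_gbinomial gbinomial_prod_rev)
  then show ?thesis by (simp add: eval_nat_numeral fact_reduce)
qed

theorem proposition5p20: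
  fixes F :: "'n::finite \<Rightarrow> real ^ 'k::finite"
    and n k :: nat
    and p v c :: real
  assumes n: "CARD('n) = n" "3 \<le> n"
    and k: "CARD('k) = k" "1 \<le> k" "k < n"
    and frame: "parseval_frame F" "two_uniform_frame F"
    and p: "2 \<le> p"
    and v: "v = 1/2 * (real n - 2 - sqrt ((real n - real k) * (real n - 1) / real k)
                         + sqrt (real k * (real n - 1) / (real n - real k)))"
    and c: "c = v - 1 - 1/4 * (sqrt ((real n - real k) * (real n - 1) / real k) - 1)
                           * (sqrt (real k * (real n - 1) / (real n - real k)) + 1)"
  shows "erasure_error 3 p F =
           (inverse (real (n choose 3)) *
             ((real k / real n + 2 * equiangular_const n k) powr p * real (even_triples F)
              + (real k / real n + equiangular_const n k) powr p * real (odd_triples F))) powr (1 / p)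
       \<and> real (odd_triples F) =
           v * (real n - 1) * c / 6 + (real n - 2 * v + c) * ((real n - 1) * v / 2)
       \<and> real (even_triples F) = real (n choose 3) - real (odd_triples F)"
proof -
  interpret equiangular_parseval_frame F "real k / real n" "equiangular_const n k"
    using two_uniform_equiangular[OF frame] n k by simp
  have total: "real (even_triples F) + real (odd_triples F) = real (n choose 3)"
    using even_triples_add_odd_triples[of F] n(1) by (metis of_nat_add)
  have kn: "0 < real k" "real k < real n" "1 < real n" using n k by auto
  note count = triangle_count_formula[OF kn equiangular_const_def v c]
  \<comment> \<open>Substituting 1 - 2k/n = b (n - 2 - 2v) exposes the common factor b on both
    sides.\<close>
  have "equiangular_const n k * (6 * (real (even_triples F) - real (odd_triples F)))
      = equiangular_const n k * ((real n - 2 - 2 * v) * real n * (real n - 1))"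
    using even_minus_odd_triples unfolding n(1) count(1)[symmetric] by (simp only: ac_simps)
  then have "6 * (real (even_triples F) - real (odd_triples F)) = (real n - 2 - 2 * v) * real n * (real n - 1)"
    using b_pos by simp
  \<comment> \<open>The difference and the sum of the two counts are known, so each is determined.
    The value agrees with every pair of indices lying in v odd triples.\<close>
  then have "real (odd_triples F) = real n * (real n - 1) * v / 6"
    using total real_choose_3[OF n(2)] by (simp add: field_simps)
  then have "real (odd_triples F) = v * (real n - 1) * c / 6 + (real n - 2 * v + c) * ((real n - 1) * v / 2)"
    by (simp only: count(2))
  then show ?thesis
    using total n(1) by (simp add: erasure_error_def sum_erasure_norm_triples)
qed

end
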